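(* Let $d\ge1$, let $I_1,\dots,I_d\subset\mathbb R$ be intervals, $\mathbf I=I_1\times\dots\times I_d$, and let $a_i,b_i\in I_i$ with $a_i<b_i$, $i=1,\dots,d$. Given probability measures $\mu_{X_i},\mu_{Y_i}$ on $I_i$ ($i=1,\dots,d$), for each $A\subset\{1,\dots,d\}$ let $Z_{1,A},\dots,Z_{d,A}$ be independent random variables such that $Z_{i,A}$ has distribution $\mu_{Y_i}$ if $i\notin A$ and distribution $\mu_{X_i}$ if $i\in A$. Then the inequality $$\sum_{A\subset\{1,\dots,d\}}(-1)^{|A|}\,\mathbb E f(Z_{1,A},\dots,Z_{d,A})\ge0$$ holds for all continuous box-$(2,\dots,2)$-convex functions $f\colon\mathbf I\to\mathbb R$ in each of the following two cases: (a) (first Hermite–Hadamard inequality) $\mu_{X_i}=\delta_{(a_i+b_i)/2}$ and $\mu_{Y_i}=\frac1{b_i-a_i}\mathbf 1_{[a_i,b_i]}(x)\,dx$ for $i=1,\dots,d$; (b) (second Hermite–Hadamard inequality) $\mu_{X_i}=\frac1{b_i-a_i}\mathbf 1_{[a_i,b_i]}(x)\,dx$ and $\mu_{Y_i}=\frac12(\delta_{a_i}+\delta_{b_i})$ for $i=1,\dots,d$.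
   Context: Divided differences: for a real function $g$ of one variable and pairwise distinct points, $[x_0;g]=g(x_0)$ and $[x_0,\dots,x_n;g]=\dfrac{[x_1,\dots,x_n;g]-[x_0,\dots,x_{n-1};g]}{x_n-x_0}$ for $n\ge1$. Multiple divided differences: for $f\colon\mathbf I\to\mathbb R$ and triples $\mathbf x_i=(x_{i0},x_{i1},x_{i2})\in I_i^{3}$ with pairwise distinct coordinates ($i=1,\dots,d$), $[\mathbf x_1;\dots;\mathbf x_d;f]$ is defined by induction on $d$: for $d=1$ it is $[x_{10},x_{11},x_{12};f]$; for $d>1$ it is $[x_{d0},x_{d1},x_{d2};g]$, where $g(x)=[\mathbf x_1;\dots;\mathbf x_{d-1};f(\cdot,\dots,\cdot,x)]$ for $x\in I_d$. $f$ is box-$(2,\dots,2)$-convex if $[\mathbf x_1;\dots;\mathbf x_d;f]\ge0$ for all such $\mathbf x_1,\dots,\mathbf x_d$. $\delta_c$ denotes the Dirac measure at $c$. *)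

theory Defs
  imports "HOL-Probability.Probability"
begin

fun divided_difference :: "real list \<Rightarrow> (real \<Rightarrow> real) \<Rightarrow> real" where
  "divided_difference [] g = 0"
| "divided_difference [x] g = g x"
| "divided_difference (x # y # xs) g =
     (divided_difference (y # xs) g - divided_difference (butlast (x # y # xs)) g)
       / (last (y # xs) - x)"

text \<open>
  A point of \<open>I 1 \<times> \<dots> \<times> I d\<close> is an element of \<open>PiE {1..d} I\<close>: a function on the index set
  \<open>{1..d}\<close> that is \<open>undefined\<close> outside it. The last coordinate of a \<open>Suc d\<close>-dimensional point
  is frozen at \<open>t\<close> by \<open>y(Suc d := t)\<close>. The clause for \<open>0\<close> evaluates at the only point of the
  empty product; the case \<open>d = 1\<close> is then the ordinary divided difference, as the lemma shows.
\<close>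

fun multiple_divided_difference ::
  "nat \<Rightarrow> (nat \<Rightarrow> real list) \<Rightarrow> ((nat \<Rightarrow> real) \<Rightarrow> real) \<Rightarrow> real" where
  "multiple_divided_difference 0 xs f = f (\<lambda>_. undefined)"
| "multiple_divided_difference (Suc d) xs f =
     divided_difference (xs (Suc d))
       (\<lambda>t. multiple_divided_difference d xs (\<lambda>y. f (y(Suc d := t))))"

lemma multiple_divided_difference_1:
  "multiple_divided_difference 1 xs f = divided_difference (xs 1) (\<lambda>t. f (\<lambda>i\<in>{1..1}. t))"
proof -
  have "(\<lambda>_. undefined)(Suc 0 := t) = (\<lambda>i\<in>{1..1}. t)" for t :: real
    by (auto simp: fun_eq_iff)
  then show ?thesis by simp
qed

definition box_2_convex :: "nat \<Rightarrow> (nat \<Rightarrow> real set) \<Rightarrow> ((nat \<Rightarrow> real) \<Rightarrow> real) \<Rightarrow> bool" where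
  "box_2_convex d I f \<longleftrightarrow>
     (\<forall>xs. (\<forall>i\<in>{1..d}. length (xs i) = 3 \<and> distinct (xs i) \<and> set (xs i) \<subseteq> I i)
        \<longrightarrow> multiple_divided_difference d xs f \<ge> 0)"

text \<open>
  The following are measures on the Borel sets of an interval \<open>J\<close>, not of the real line, so that
  a random variable with such a law takes all its values in \<open>J\<close>.
\<close>

abbreviation borel_on :: "real set \<Rightarrow> real measure" where
  "borel_on J \<equiv> restrict_space borel J"

definition dirac_on :: "real set \<Rightarrow> real \<Rightarrow> real measure" where
  "dirac_on J c = return (borel_on J) c"

definition uniform_on :: "real set \<Rightarrow> real \<Rightarrow> real \<Rightarrow> real measure" where
  "uniform_on J a b =
     density (restrict_space lborel J) (\<lambda>x. ennreal (1 / (b - a) * indicator {a..b} x))"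

definition endpoints_on :: "real set \<Rightarrow> real \<Rightarrow> real \<Rightarrow> real measure" where
  "endpoints_on J a b = measure_of J (sets (borel_on J))
     (\<lambda>S. (emeasure (dirac_on J a) S + emeasure (dirac_on J b) S) / 2)"

text \<open>The set function in \<open>endpoints_on\<close> is a measure, so \<open>measure_of\<close> does not degenerate.\<close>

lemma sets_endpoints_on [simp]: "sets (endpoints_on J a b) = sets (borel_on J)"
  and space_endpoints_on [simp]: "space (endpoints_on J a b) = J"
proof -
  have "sets (borel_on J) \<subseteq> Pow J"
    using sets.space_closed[of "borel_on J"] by (simp add: space_restrict_space)
  moreover have "sigma_sets J (sets (borel_on J)) = sets (borel_on J)"
    using sets.sigma_sets_eq[of "borel_on J"] by (simp add: space_restrict_space)
  ultimately show "sets (endpoints_on J a b) = sets (borel_on J)"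
      "space (endpoints_on J a b) = J"
    by (simp_all add: endpoints_on_def)
qed

lemma emeasure_endpoints_on:
  assumes "S \<in> sets (borel_on J)"
  shows "emeasure (endpoints_on J a b) S =
    (emeasure (dirac_on J a) S + emeasure (dirac_on J b) S) / 2"
proof (rule emeasure_measure_of[OF endpoints_on_def])
  show "sets (borel_on J) \<subseteq> Pow J"
    using sets.space_closed[of "borel_on J"] by (simp add: space_restrict_space)
  show "positive (sets (endpoints_on J a b))
      (\<lambda>S. (emeasure (dirac_on J a) S + emeasure (dirac_on J b) S) / 2)"
    by (simp add: positive_def)
  show "countably_additive (sets (endpoints_on J a b))
      (\<lambda>S. (emeasure (dirac_on J a) S + emeasure (dirac_on J b) S) / 2)"
  proof (rule countably_additiveI)
    fix F :: "nat \<Rightarrow> real set"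
    assume F: "range F \<subseteq> sets (endpoints_on J a b)" "disjoint_family F"
    have "(\<Sum>i. emeasure (dirac_on J c) (F i)) = emeasure (dirac_on J c) (\<Union>i. F i)" for c
      by (rule suminf_emeasure) (use F in \<open>auto simp: dirac_on_def\<close>)
    then show "(\<Sum>i. (emeasure (dirac_on J a) (F i) + emeasure (dirac_on J b) (F i)) / 2) =
        (emeasure (dirac_on J a) (\<Union>i. F i) + emeasure (dirac_on J b) (\<Union>i. F i)) / 2"
      by (simp add: ennreal_suminf_divide suminf_add[symmetric])
  qed
  show "S \<in> sets (endpoints_on J a b)" using assms by simp
qed

end

theory Submission
  imports Defs
begin

text \<open>
  The alternating sum is the integral of \<open>f\<close> against the product of the signed measures
  \<open>\<mu>Y i - \<mu>X i\<close>. Integrate out all coordinates but the last: by induction on \<open>d\<close>, applied to the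
  divided differences of \<open>f\<close> in the last variable, the resulting function of that variable has
  nonnegative second divided differences. It is therefore convex, and the one-dimensional
  Hermite-Hadamard inequality finishes the induction step.
\<close>

section \<open>Divided differences\<close>

text \<open>A continuous \<open>f\<close> need not be bounded on \<open>PiE {1..d} I\<close>, and it
  need not be convex in any single variable; convexity appears only after the other variables have
  been integrated against the signed measures. All laws are concentrated on the compact box with
  sides \<open>{a i..b i}\<close>, so bounds, integrability and convexity are established there.
  Divided differences are finite linear combinations of values, hence those in different variables
  commute with each other and, given integrability, with integrals; this turns the induction
  hypothesis into convexity. The two cases of the theorem enter through one common property: a
  bounded measurable function that is convex on \<open>{a i..b i}\<close> has an integral under
  \<open>\<mu>X i\<close> at most equal to that under \<open>\<mu>Y i\<close>. The induction starts
  at dimension 0, where the alternating sum is the value of \<open>f\<close> at the only point of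
  the empty product.\<close>

lemma divided_difference_3:
  "divided_difference [p, q, r] g = ((g r - g q) / (r - q) - (g q - g p) / (q - p)) / (r - p)"
  by simp

text \<open>As \<open>r - p > 0\<close>, the sign condition says that the chord slope to the left of
  \<open>q\<close> is at most the one to its right. When \<open>q\<close> divides
  \<open>[x, y]\<close> in the ratio \<open>t\<close>, clearing denominators and cancelling
  \<open>y - x\<close> gives the convexity inequality.\<close>

lemma convex_on_if_divided_difference_nonneg:
  fixes g :: "real \<Rightarrow> real"
  assumes "convex S"
    and nonneg: "\<And>p q r. {p, q, r} \<subseteq> S \<Longrightarrow> p < q \<Longrightarrow> q < r \<Longrightarrow> divided_difference [p, q, r] g \<ge> 0"
  shows "convex_on S g"
proof
  fix t x y :: real
  assume t: "0 < t" "t < 1" and xy: "x \<in> S" "y \<in> S" "x < y"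
  define q where "q = (1 - t) *\<^sub>R x + t *\<^sub>R y"
  have "q \<in> S"
    unfolding q_def using t xy \<open>convex S\<close> by (intro convexD) auto
  have q1: "q - x = t * (y - x)" and q2: "y - q = (1 - t) * (y - x)"
    by (auto simp: q_def algebra_simps)
  have "x < q" "q < y"
    using q1 q2 t xy by (smt (verit) mult_pos_pos)+
  then have "divided_difference [x, q, y] g \<ge> 0"
    using nonneg \<open>q \<in> S\<close> xy by auto
  then have "(g q - g x) / (q - x) \<le> (g y - g q) / (y - q)"
    using xy unfolding divided_difference_3 by (simp add: zero_le_divide_iff)
  then have "(g q - g x) * (y - q) \<le> (g y - g q) * (q - x)"
    using \<open>x < q\<close> \<open>q < y\<close> by (simp add: field_simps)
  then have "((g q - g x) * (1 - t)) * (y - x) \<le> ((g y - g q) * t) * (y - x)"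
    unfolding q1 q2 by (simp add: mult.assoc)
  then have "(g q - g x) * (1 - t) \<le> (g y - g q) * t"
    using xy by simp
  then show "g ((1 - t) *\<^sub>R x + t *\<^sub>R y) \<le> (1 - t) * g x + t * g y"
    unfolding q_def[symmetric] by (simp add: algebra_simps)
qed fact

text \<open>Linearity in exactly the shape of the recursive clause of
  \<open>divided_difference\<close>, so that one rewrite can pull such a step out of another divided
  difference.\<close>

lemma divided_difference_diff_divide:
  "divided_difference ps (\<lambda>t. (g t - h t) / c) =
     (divided_difference ps g - divided_difference ps h) / c"
  by (induction ps g arbitrary: h rule: divided_difference.induct)
     (simp_all add: diff_divide_distrib mult.commute)

lemma multiple_divided_difference_diff_divide:
  "multiple_divided_difference d xs (\<lambda>y. (f y - g y) / c) =
     (multiple_divided_difference d xs f - multiple_divided_difference d xs g) / c"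
  by (induction d arbitrary: f g) (simp_all add: divided_difference_diff_divide)

text \<open>The inner operator is an iterated difference quotient and the outer operator is linear,
  so each difference quotient can be moved outside.\<close>

lemma multiple_divided_difference_commute:
  "multiple_divided_difference d xs (\<lambda>y. divided_difference ps (\<lambda>t. F t y)) =
     divided_difference ps (\<lambda>t. multiple_divided_difference d xs (F t))"
\<comment> \<open>The rule has a slot for the function argument of
  \<open>divided_difference\<close>; the zero function is a dummy there, since \<open>F\<close>
  stays fixed while the list shrinks.\<close>
proof (induction ps "\<lambda>_::real. 0::real" rule: divided_difference.induct)
  case 1
  show ?case
    \<comment> \<open>The empty list leaves the zero function, whose multiple divided difference
      vanishes by linearity applied to \<open>(0 - 0) / 1\<close>.\<close>
    using multiple_divided_difference_diff_divide[of d xs "\<lambda>_. 0" "\<lambda>_. 0" 1] by simp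
next
  case (3 x y ps)
  then show ?case
    by (simp add: multiple_divided_difference_diff_divide del: butlast.simps)
qed simp

lemma multiple_divided_difference_cong:
  "(\<And>i. i \<in> {1..d} \<Longrightarrow> xs i = ys i) \<Longrightarrow>
     multiple_divided_difference d xs f = multiple_divided_difference d ys f"
proof (induction d arbitrary: f)
  case (Suc d)
  then have "xs (Suc d) = ys (Suc d)"
    and "multiple_divided_difference d xs g = multiple_divided_difference d ys g" for g
    by auto
  then show ?case by simp
qed simp

lemma box_2_convex_mono:
  assumes "box_2_convex d I f" "\<And>i. i \<in> {1..d} \<Longrightarrow> J i \<subseteq> I i"
  shows "box_2_convex d J f"
  unfolding box_2_convex_def
proof (intro allI impI)
  fix xs assume "\<forall>i\<in>{1..d}. length (xs i) = 3 \<and> distinct (xs i) \<and> set (xs i) \<subseteq> J i"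
  then have "\<forall>i\<in>{1..d}. length (xs i) = 3 \<and> distinct (xs i) \<and> set (xs i) \<subseteq> I i"
    using assms(2) by (meson subset_trans)
  then show "multiple_divided_difference d xs f \<ge> 0"
    using assms(1) unfolding box_2_convex_def by blast
qed

text \<open>This makes the induction hypothesis applicable: by commutation, a \<open>d\<close>-fold
  difference of the new function is a \<open>Suc d\<close>-fold difference of \<open>f\<close> with
  the triple \<open>[p, q, r]\<close> in the last slot.\<close>

lemma box_2_convex_divided_difference:
  assumes "box_2_convex (Suc d) J f" "{p, q, r} \<subseteq> J (Suc d)" "distinct [p, q, r]"
  shows "box_2_convex d J (\<lambda>y. divided_difference [p, q, r] (\<lambda>t. f (y(Suc d := t))))"
  unfolding box_2_convex_def
proof (intro allI impI)
  fix xs assume xs: "\<forall>i\<in>{1..d}. length (xs i) = 3 \<and> distinct (xs i) \<and> set (xs i) \<subseteq> J i"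
  define ys where "ys = xs(Suc d := [p, q, r])"
  have "\<forall>i\<in>{1..Suc d}. length (ys i) = 3 \<and> distinct (ys i) \<and> set (ys i) \<subseteq> J i"
    using xs assms(2,3) by (auto simp: ys_def le_Suc_eq)
  then have "multiple_divided_difference (Suc d) ys f \<ge> 0"
    using assms(1) unfolding box_2_convex_def by blast
  moreover have "multiple_divided_difference d ys g = multiple_divided_difference d xs g" for g
    by (rule multiple_divided_difference_cong) (auto simp: ys_def)
  ultimately show "multiple_divided_difference d xs
      (\<lambda>y. divided_difference [p, q, r] (\<lambda>t. f (y(Suc d := t)))) \<ge> 0"
    unfolding multiple_divided_difference_commute by (simp add: ys_def)
qed

section \<open>Continuous functions on boxes\<close>

text \<open>Extensional functions are a full product whose factors outside \<open>J\<close> are the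
  singleton \<open>{undefined}\<close>, so Tychonoff's theorem applies.\<close>

lemma compact_PiE_box:
  fixes S :: "nat \<Rightarrow> real set"
  assumes "\<And>i. i \<in> J \<Longrightarrow> compact (S i)"
  shows "compact (PiE J S)"
proof -
  have "PiE J S = PiE UNIV (\<lambda>i. if i \<in> J then S i else {undefined})"
    by (auto simp: PiE_def Pi_def extensional_def split: if_splits)
  moreover have "compactin (product_topology (\<lambda>_. euclidean) UNIV)
      (PiE UNIV (\<lambda>i. if i \<in> J then S i else {undefined}))"
    unfolding compactin_PiE using assms by auto
  ultimately show ?thesis
    by (simp add: euclidean_product_topology)
qed

lemma continuous_on_PiE_fun_upd:
  fixes f :: "(nat \<Rightarrow> real) \<Rightarrow> real"
  assumes "continuous_on (PiE {1..Suc d} I) f" "t \<in> I (Suc d)"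
  shows "continuous_on (PiE {1..d} I) (\<lambda>y. f (y(Suc d := t)))"
proof (rule continuous_on_compose2[OF assms(1)])
  show "continuous_on (PiE {1..d} I) (\<lambda>y. y(Suc d := t))"
  proof (rule continuous_on_coordinatewise_then_product)
    fix i show "continuous_on (PiE {1..d} I) (\<lambda>y. (y(Suc d := t)) i)"
      by (cases "i = Suc d") (auto intro: continuous_on_product_coordinates continuous_on_subset)
  qed
  show "(\<lambda>y. y(Suc d := t)) ` PiE {1..d} I \<subseteq> PiE {1..Suc d} I"
    using assms(2) by (auto simp: PiE_def Pi_def extensional_def le_Suc_eq)
qed

text \<open>Continuity refers to the topology of the full space
  \<open>nat \<Rightarrow> real\<close>, measurability to the coordinates in \<open>J\<close>. The
  identity links the two: coordinates outside \<open>J\<close> are constantly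
  \<open>undefined\<close>, and for the countable index type the product sigma-algebra is the Borel
  one.\<close>

lemma borel_measurable_PiM_continuous_on:
  fixes f :: "(nat \<Rightarrow> real) \<Rightarrow> real"
  assumes f: "continuous_on (PiE J I) f"
  shows "f \<in> borel_measurable (PiM J (\<lambda>i. borel_on (I i)))"
proof -
  have "(\<lambda>y. y i) \<in> borel_measurable (PiM J (\<lambda>i. borel_on (I i)))" for i
  proof (cases "i \<in> J")
    case True
    then have "(\<lambda>y. y i) \<in> PiM J (\<lambda>i. borel_on (I i)) \<rightarrow>\<^sub>M borel_on (I i)"
      by simp
    then show ?thesis
      by (simp add: measurable_restrict_space2_iff)
  next
    case False
    then have "(\<lambda>y. y i) \<in> borel_measurable (PiM J (\<lambda>i. borel_on (I i))) \<longleftrightarrow>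
        (\<lambda>_. undefined :: real) \<in> borel_measurable (PiM J (\<lambda>i. borel_on (I i)))"
      by (intro measurable_cong) (auto simp: space_PiM PiE_def extensional_def)
    then show ?thesis by simp
  qed
  then have "(\<lambda>y. y) \<in> PiM J (\<lambda>i. borel_on (I i)) \<rightarrow>\<^sub>M PiM UNIV (\<lambda>_. borel)"
    by (intro measurable_PiM_single') auto
  then have "(\<lambda>y. y) \<in> PiM J (\<lambda>i. borel_on (I i)) \<rightarrow>\<^sub>M borel"
    by (simp only: measurable_cong_sets[OF refl sets_PiM_equal_borel])
  then have "(\<lambda>y. y) \<in> PiM J (\<lambda>i. borel_on (I i)) \<rightarrow>\<^sub>M restrict_space borel (PiE J I)"
    by (intro measurable_restrict_space2) (auto simp: space_PiM space_restrict_space)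
  from measurable_compose[OF this borel_measurable_continuous_on_restrict[OF f]]
  show ?thesis .
qed

section \<open>The one-dimensional Hermite-Hadamard inequalities\<close>

context
  fixes J :: "real set" and a b :: real
  assumes J: "is_interval J" "a \<in> J" "b \<in> J" "a < b"
begin

lemma Icc_subset_interval: "{a..b} \<subseteq> J"
  using mem_is_interval_1_I[OF J(1-3)] by (simp add: subset_iff)

lemma interval_borel: "J \<in> sets borel"
  using J(1) by (rule real_interval_borel_measurable)

lemma sets_borel_on_iff: "S \<in> sets (borel_on J) \<longleftrightarrow> S \<subseteq> J \<and> S \<in> sets borel"
  by (rule sets_restrict_space_iff) (simp add: interval_borel)

lemma sets_uniform_on: "sets (uniform_on J a b) = sets (borel_on J)"
  by (simp add: uniform_on_def sets_restrict_space)

lemma integral_uniform_on: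
  assumes g: "g \<in> borel_measurable (borel_on J)"
  shows "(\<integral>t. g t \<partial>uniform_on J a b) = (\<integral>t. g t * indicator {a..b} t \<partial>lborel) / (b - a)"
proof -
  have [measurable]: "g \<in> borel_measurable (restrict_space lborel J)"
    using g by (simp cong: measurable_cong_sets add: sets_restrict_space)
  have [measurable]: "indicator {a..b} \<in> borel_measurable (restrict_space lborel J)"
    by (intro measurable_restrict_space1 borel_measurable_indicator) simp
  have "(\<integral>t. g t \<partial>uniform_on J a b) =
      (\<integral>t. (1 / (b - a) * indicator {a..b} t) *\<^sub>R g t \<partial>restrict_space lborel J)"
  proof -
    have "uniform_on J a b =
        density (restrict_space lborel J) (\<lambda>t. ennreal (1 / (b - a) * indicator {a..b} t))"
      using J(4) by (auto simp: uniform_on_def intro!: arg_cong2[where f = density] split: split_indicator)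
    then show ?thesis
      using J(4) by (simp add: integral_density)
  qed
  also have "\<dots> = (\<integral>t. indicator J t *\<^sub>R ((1 / (b - a) * indicator {a..b} t) *\<^sub>R g t) \<partial>lborel)"
    by (rule integral_restrict_space) (simp add: interval_borel)
  also have "\<dots> = (\<integral>t. (g t * indicator {a..b} t) / (b - a) \<partial>lborel)"
    using Icc_subset_interval by (intro Bochner_Integration.integral_cong) (auto split: split_indicator)
  finally show ?thesis by simp
qed

lemma AE_uniform_on: "AE t in uniform_on J a b. t \<in> {a..b}"
proof -
  have [measurable]: "indicator {a..b} \<in> borel_measurable (restrict_space lborel J)"
    by (intro measurable_restrict_space1 borel_measurable_indicator) simp
  show ?thesis
    unfolding uniform_on_def
    by (subst AE_density) (measurable, auto intro!: AE_I2 split: split_indicator_asm)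
qed

lemma prob_space_uniform_on: "prob_space (uniform_on J a b)"
proof
  have [measurable]: "indicator {a..b} \<in> borel_measurable (restrict_space lborel J)"
    by (intro measurable_restrict_space1 borel_measurable_indicator) simp
  have "J \<in> sets (restrict_space lborel J)"
    using sets.top[of "restrict_space lborel J"] by (simp add: space_restrict_space)
  then have "emeasure (uniform_on J a b) (space (uniform_on J a b)) =
      (\<integral>\<^sup>+t. ennreal (1 / (b - a)) * indicator {a..b} t \<partial>restrict_space lborel J)"
    unfolding uniform_on_def by (subst emeasure_density)
      (auto intro!: nn_integral_cong split: split_indicator simp: space_restrict_space)
  also have "\<dots> = (\<integral>\<^sup>+t. ennreal (1 / (b - a)) * indicator {a..b} t \<partial>lborel)"
    using Icc_subset_interval by (subst nn_integral_restrict_space)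
      (auto intro!: nn_integral_cong split: split_indicator simp: interval_borel)
  also have "\<dots> = 1"
    using J(4) by (simp add: nn_integral_cmult ennreal_mult[symmetric])
  finally show "emeasure (uniform_on J a b) (space (uniform_on J a b)) = 1" .
qed

text \<open>Both Hermite-Hadamard inequalities compare \<open>g\<close> with an affine function, so
  this mean yields both bounds.\<close>

lemma integral_affine_uniform_on:
  "(\<integral>t. c + e * t \<partial>uniform_on J a b) = c + e * ((a + b) / 2)"
proof -
  \<comment> \<open>The power \<open>t ^ 1\<close> is written out to match
    \<open>integral_power\<close>.\<close>
  have "(\<integral>t. (c + e * t) * indicator {a..b} t \<partial>lborel) =
      (\<integral>t. c * indicator {a..b} t + e * (t ^ 1 * indicator {a..b} t) \<partial>lborel)"
    by (simp add: algebra_simps)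
  also have "\<dots> = c * (b - a) + e * ((b\<^sup>2 - a\<^sup>2) / 2)"
  proof -
    have "integrable lborel (\<lambda>t. e * (t ^ 1 * indicator {a..b} t))"
      using borel_integrable_atLeastAtMost'[of a b "\<lambda>t. t"]
      by (simp add: set_integrable_def mult.commute continuous_on_id)
    moreover have "integrable lborel (\<lambda>t. c * indicator {a..b} t)"
      by (intro integrable_mult_right integrable_real_indicator) (simp_all add: emeasure_lborel_Icc_eq)
    ultimately show ?thesis
      using J(4) integral_power[of a b 1] by (simp add: power2_eq_square)
  qed
  also have "\<dots> = (c + e * ((a + b) / 2)) * (b - a)"
    by (simp add: power2_eq_square algebra_simps add_divide_distrib diff_divide_distrib)
  finally show ?thesis
    using J(4) by (subst integral_uniform_on) (auto intro: measurable_restrict_space1)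
qed

lemma integral_dirac_on:
  "c \<in> J \<Longrightarrow> g \<in> borel_measurable (borel_on J) \<Longrightarrow> (\<integral>t. g t \<partial>dirac_on J c) = (g c :: real)"
  unfolding dirac_on_def by (rule integral_return) (simp_all add: space_restrict_space)

lemma AE_dirac_on:
  assumes "c \<in> {a..b}"
  shows "AE t in dirac_on J c. t \<in> {a..b}"
proof -
  have "Measurable.pred (borel_on J) (\<lambda>t. t \<in> {a..b})"
    by (rule measurable_restrict_space1) simp
  moreover have "c \<in> space (borel_on J)"
    using assms Icc_subset_interval by (auto simp: space_restrict_space)
  ultimately show ?thesis
    unfolding dirac_on_def using AE_return[of c "borel_on J" "\<lambda>t. t \<in> {a..b}"] assms by simp
qed

lemma emeasure_endpoints_on_indicator:
  assumes "S \<in> sets (borel_on J)"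
  shows "emeasure (endpoints_on J a b) S = (indicator S a + indicator S b) / 2"
  using assms by (simp add: emeasure_endpoints_on dirac_on_def)

lemma AE_endpoints_on: "AE t in endpoints_on J a b. t \<in> {a, b}"
proof (rule AE_I')
  have *: "J - {a, b} \<in> sets (borel_on J)"
    using interval_borel by (auto simp: sets_borel_on_iff)
  then show "J - {a, b} \<in> null_sets (endpoints_on J a b)"
    by (simp add: null_sets_def emeasure_endpoints_on_indicator)
qed auto

text \<open>\<open>endpoints_on\<close> is given by its values on sets. Being concentrated on
  \<open>{a, b}\<close>, it sees \<open>g\<close> as a combination of two indicators, whose
  integrals are the masses of the atoms.\<close>

lemma integral_endpoints_on:
  fixes g :: "real \<Rightarrow> real"
  assumes g: "g \<in> borel_measurable (borel_on J)"
  shows "(\<integral>t. g t \<partial>endpoints_on J a b) = (g a + g b) / 2"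
proof -
  let ?E = "endpoints_on J a b"
  have sets: "{c} \<in> sets (borel_on J)" if "c \<in> J" for c
    using that by (simp add: sets_borel_on_iff)
  \<comment> \<open>Since \<open>a < b\<close>, the two atoms are distinct and neither receives both
    halves of the mass.\<close>
  have half: "emeasure ?E {c} = ennreal (1 / 2)" if "c \<in> {a, b}" for c
  proof -
    have "c \<in> J" using that J by auto
    moreover have "indicator {c} a + indicator {c} b = (1 :: ennreal)"
      using that J(4) by auto
    moreover have "(1 :: ennreal) / 2 = ennreal (1 / 2)"
      using divide_ennreal[of 1 2] by simp
    ultimately show ?thesis
      by (simp only: emeasure_endpoints_on_indicator[OF sets])
  qed
  have [measurable]: "{a} \<in> sets ?E" "{b} \<in> sets ?E"
    using J sets by auto
  have [measurable]: "g \<in> borel_measurable ?E"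
    using g by (simp only: measurable_cong_sets[OF sets_endpoints_on refl])
  have "(\<integral>t. g t \<partial>?E) = (\<integral>t. g a * indicator {a} t + g b * indicator {b} t \<partial>?E)"
    using AE_endpoints_on J(4) by (intro integral_cong_AE) (auto split: split_indicator)
  also have "\<dots> = g a * measure ?E {a} + g b * measure ?E {b}"
  proof -
    have "integrable ?E (\<lambda>t. g c * indicator {c} t)" if "c \<in> {a, b}" for c
    proof (intro integrable_mult_right integrable_real_indicator)
      show "{c} \<in> sets ?E" using that J sets by auto
      show "emeasure ?E {c} < \<infinity>" by (simp only: half[OF that] infinity_ennreal_def ennreal_less_top)
    qed
    then show ?thesis
      using J by simp
  qed
  also have "\<dots> = (g a + g b) / 2"
  proof -
    have "measure ?E {c} = 1 / 2" if "c \<in> {a, b}" for c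
      using half[OF that] by (intro measure_eq_emeasure_eq_ennreal) simp_all
    from this[of a] this[of b] show ?thesis
      by (simp only: insertI1 insertI2 simp_thms) (simp add: add_divide_distrib)
  qed
  finally show ?thesis .
qed

text \<open>A supporting line at the midpoint bounds \<open>g\<close> from below and the chord
  bounds it from above. The uniform law has mean \<open>(a + b) / 2\<close>, so the integrals of
  these affine functions are the two claimed bounds. The bound \<open>B\<close> provides
  integrability.\<close>

lemma
  fixes g :: "real \<Rightarrow> real"
  assumes g: "g \<in> borel_measurable (borel_on J)" and conv: "convex_on {a..b} g"
    and bound: "\<And>t. t \<in> {a..b} \<Longrightarrow> \<bar>g t\<bar> \<le> B"
  shows hermite_hadamard_midpoint: "g ((a + b) / 2) \<le> (\<integral>t. g t \<partial>uniform_on J a b)"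
    and hermite_hadamard_endpoints: "(\<integral>t. g t \<partial>uniform_on J a b) \<le> (g a + g b) / 2"
proof -
  let ?U = "uniform_on J a b"
  interpret U: prob_space ?U by (rule prob_space_uniform_on)
  have "g \<in> borel_measurable ?U"
    using g by (simp only: measurable_cong_sets[OF sets_uniform_on refl])
  then have int_g: "integrable ?U g"
    using AE_uniform_on bound by (intro U.integrable_const_bound[where B = B]) auto
  have "(\<lambda>t. c + e * t) \<in> borel_measurable ?U" for c e
    unfolding measurable_cong_sets[OF sets_uniform_on refl]
    by (rule measurable_restrict_space1) simp
  moreover have "AE t in ?U. norm (c + e * t) \<le> \<bar>c\<bar> + \<bar>e\<bar> * (\<bar>a\<bar> + \<bar>b\<bar>)" for c e
    using AE_uniform_on
  proof eventually_elim
    fix t assume "t \<in> {a..b}"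
    then have "\<bar>e\<bar> * \<bar>t\<bar> \<le> \<bar>e\<bar> * (\<bar>a\<bar> + \<bar>b\<bar>)"
      by (intro mult_left_mono) auto
    then show "norm (c + e * t) \<le> \<bar>c\<bar> + \<bar>e\<bar> * (\<bar>a\<bar> + \<bar>b\<bar>)"
      using abs_triangle_ineq[of c "e * t"] by (simp add: abs_mult)
  qed
  ultimately have int_affine: "integrable ?U (\<lambda>t. c + e * t)" for c e
    by (intro U.integrable_const_bound) auto

  define m where "m = (a + b) / 2"
  \<comment> \<open>A supporting line of finite slope is guaranteed at interior points; here the
    slope is an infimum of difference quotients.\<close>
  have "m \<in> interior {a..b}" using J(4) by (simp add: m_def interior_atLeastAtMost_real)
  then obtain s where s: "\<And>t. t \<in> {a..b} \<Longrightarrow> g m + s * (t - m) \<le> g t"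
    using convex_le_Inf_differential[OF conv] by blast
  have "g m = (\<integral>t. (g m - s * m) + s * t \<partial>?U)"
    by (simp add: integral_affine_uniform_on m_def[symmetric])
  also have "\<dots> \<le> (\<integral>t. g t \<partial>?U)"
    using AE_uniform_on s by (intro integral_mono_AE int_affine int_g) (auto simp: algebra_simps)
  finally show "g ((a + b) / 2) \<le> (\<integral>t. g t \<partial>?U)" by (simp add: m_def)

  define e where "e = (g b - g a) / (b - a)"
  have "g t \<le> (g a - e * a) + e * t" if t: "t \<in> {a..b}" for t
    using convex_onD_Icc'[OF conv t, folded e_def] by (simp add: algebra_simps)
  then have "(\<integral>t. g t \<partial>?U) \<le> (\<integral>t. (g a - e * a) + e * t \<partial>?U)"
    using AE_uniform_on by (intro integral_mono_AE int_affine int_g) auto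
  also have "\<dots> = g a + e * (b - a) / 2"
    unfolding integral_affine_uniform_on
    by (simp add: algebra_simps add_divide_distrib diff_divide_distrib)
  also have "e * (b - a) = g b - g a"
    using J(4) by (simp add: e_def)
  also have "g a + (g b - g a) / 2 = (g a + g b) / 2"
    by (simp add: field_simps)
  finally show "(\<integral>t. g t \<partial>?U) \<le> (g a + g b) / 2" .
qed

end

section \<open>Alternating sums of integrals over product measures\<close>

text \<open>The laws live on \<open>I i\<close>, where continuous functions may be unbounded, but
  they charge only the compact intervals \<open>{a i..b i}\<close>; hence every continuous function
  on a finite box is integrable. The assumptions cover all indices, so products over any
  \<open>J\<close> come without side conditions.\<close>

locale box_prob_family =
  fixes I :: "nat \<Rightarrow> real set" and a b :: "nat \<Rightarrow> real" and \<nu> :: "nat \<Rightarrow> real measure"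
  assumes prob_space_family: "\<And>i. prob_space (\<nu> i)"
    and sets_family [simp, measurable_cong]: "\<And>i. sets (\<nu> i) = sets (borel_on (I i))"
    and AE_family: "\<And>i. AE t in \<nu> i. t \<in> {a i..b i}"
    and Icc_subset: "\<And>i. {a i..b i} \<subseteq> I i"
begin

lemma prob_space_box: "prob_space (PiM J \<nu>)"
  by (intro prob_space_PiM prob_space_family)

lemma AE_box: "finite J \<Longrightarrow> AE y in PiM J \<nu>. y \<in> (\<Pi>\<^sub>E i\<in>J. {a i..b i})"
proof -
  assume "finite J"
  then have "AE y in PiM J \<nu>. \<forall>i\<in>J. y i \<in> {a i..b i}"
    by (intro eventually_ball_finite ballI AE_PiM_component prob_space_family AE_family)
  with AE_space show ?thesis
    by eventually_elim (auto simp: space_PiM PiE_def Pi_def)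
qed

lemma measurable_box:
  fixes f :: "(nat \<Rightarrow> real) \<Rightarrow> real"
  assumes "continuous_on (PiE J I) f"
  shows "f \<in> borel_measurable (PiM J \<nu>)"
proof -
  have "sets (PiM J \<nu>) = sets (PiM J (\<lambda>i. borel_on (I i)))"
    by (intro sets_PiM_cong) simp_all
  from measurable_cong_sets[OF this refl] show ?thesis
    using borel_measurable_PiM_continuous_on[OF assms] by simp
qed

lemma bounded_box:
  fixes f :: "(nat \<Rightarrow> real) \<Rightarrow> real"
  assumes f: "continuous_on (PiE J I) f"
  obtains B where "\<And>y. y \<in> (\<Pi>\<^sub>E i\<in>J. {a i..b i}) \<Longrightarrow> \<bar>f y\<bar> \<le> B"
proof -
  have "continuous_on (\<Pi>\<^sub>E i\<in>J. {a i..b i}) f"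
    using f by (rule continuous_on_subset) (intro PiE_mono Icc_subset)
  moreover have "compact (\<Pi>\<^sub>E i\<in>J. {a i..b i})"
    by (intro compact_PiE_box) simp
  ultimately have "bounded (f ` (\<Pi>\<^sub>E i\<in>J. {a i..b i}))"
    by (intro compact_imp_bounded compact_continuous_image)
  then show thesis
    using that by (force simp: bounded_iff)
qed

lemma integrable_box:
  fixes f :: "(nat \<Rightarrow> real) \<Rightarrow> real"
  assumes f: "continuous_on (PiE J I) f" and "finite J"
  shows "integrable (PiM J \<nu>) f"
proof -
  interpret P: prob_space "PiM J \<nu>" by (rule prob_space_box)
  obtain B where "\<And>y. y \<in> (\<Pi>\<^sub>E i\<in>J. {a i..b i}) \<Longrightarrow> \<bar>f y\<bar> \<le> B"
    using bounded_box[OF f] by blast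
  with AE_box[OF \<open>finite J\<close>] have "AE y in PiM J \<nu>. norm (f y) \<le> B"
    by (auto elim: eventually_mono)
  then show ?thesis
    using measurable_box[OF f] by (rule P.integrable_const_bound)
qed

lemma abs_integral_box_le:
  fixes f :: "(nat \<Rightarrow> real) \<Rightarrow> real"
  assumes f: "continuous_on (PiE J I) f" and "finite J"
    and B: "\<And>y. y \<in> (\<Pi>\<^sub>E i\<in>J. {a i..b i}) \<Longrightarrow> \<bar>f y\<bar> \<le> B"
  shows "\<bar>\<integral>y. f y \<partial>PiM J \<nu>\<bar> \<le> B"
proof -
  interpret P: prob_space "PiM J \<nu>" by (rule prob_space_box)
  have "AE y in PiM J \<nu>. \<bar>f y\<bar> \<le> B"
    using AE_box[OF \<open>finite J\<close>] by (rule eventually_mono) (rule B)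
  then have "(\<integral>y. \<bar>f y\<bar> \<partial>PiM J \<nu>) \<le> B"
    by (intro P.integral_le_const integrable_abs integrable_box assms)
  then show ?thesis
    using integral_abs_bound[of "PiM J \<nu>" f] by linarith
qed

text \<open>Fubini's theorem, once the product over \<open>{1..Suc d}\<close> is recognised as the
  image of a pair product under \<open>?u\<close>. The last coordinate is the first component of the
  pair, which makes it the outer variable of integration.\<close>

lemma
  fixes f :: "(nat \<Rightarrow> real) \<Rightarrow> real"
  assumes f: "continuous_on (PiE {1..Suc d} I) f"
  shows integrable_box_section: "integrable (\<nu> (Suc d)) (\<lambda>t. \<integral>y. f (y(Suc d := t)) \<partial>PiM {1..d} \<nu>)"
    and integral_box_Suc: "(\<integral>y. f y \<partial>PiM {1..Suc d} \<nu>) =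
      (\<integral>t. (\<integral>y. f (y(Suc d := t)) \<partial>PiM {1..d} \<nu>) \<partial>\<nu> (Suc d))"
proof -
  interpret N: prob_space "\<nu> (Suc d)" by (rule prob_space_family)
  interpret P: prob_space "PiM {1..d} \<nu>" by (rule prob_space_box)
  interpret pair_sigma_finite "\<nu> (Suc d)" "PiM {1..d} \<nu>" ..
  let ?u = "\<lambda>(t, y). y(Suc d := t)"
  have ins: "{1..Suc d} = insert (Suc d) {1..d}" by auto
  have distr: "distr (\<nu> (Suc d) \<Otimes>\<^sub>M PiM {1..d} \<nu>) (PiM {1..Suc d} \<nu>) ?u = PiM {1..Suc d} \<nu>"
    unfolding ins by (rule distr_pair_PiM_eq_PiM) (rule prob_space_family)+
  have u: "?u \<in> \<nu> (Suc d) \<Otimes>\<^sub>M PiM {1..d} \<nu> \<rightarrow>\<^sub>M PiM {1..Suc d} \<nu>"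
    unfolding split_beta by (rule measurable_fun_upd[where J = "{1..d}"]) auto
  have "integrable (\<nu> (Suc d) \<Otimes>\<^sub>M PiM {1..d} \<nu>) (\<lambda>p. f (?u p))"
    using u by (rule integrable_distr) (simp only: distr integrable_box[OF f] finite_atLeastAtMost)
  then have int: "integrable (\<nu> (Suc d) \<Otimes>\<^sub>M PiM {1..d} \<nu>) (\<lambda>(t, y). f (y(Suc d := t)))"
    by (simp only: case_prod_beta')
  then show "integrable (\<nu> (Suc d)) (\<lambda>t. \<integral>y. f (y(Suc d := t)) \<partial>PiM {1..d} \<nu>)"
    using integrable_fst by blast
  have "(\<integral>y. f y \<partial>PiM {1..Suc d} \<nu>) = (\<integral>p. f (?u p) \<partial>(\<nu> (Suc d) \<Otimes>\<^sub>M PiM {1..d} \<nu>))"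
    using integral_distr[OF u measurable_box[OF f]] by (simp only: distr)
  also have "\<dots> = (\<integral>t. (\<integral>y. f (y(Suc d := t)) \<partial>PiM {1..d} \<nu>) \<partial>\<nu> (Suc d))"
    using integral_fst'[OF int] by (simp add: case_prod_beta')
  finally show "(\<integral>y. f y \<partial>PiM {1..Suc d} \<nu>) =
      (\<integral>t. (\<integral>y. f (y(Suc d := t)) \<partial>PiM {1..d} \<nu>) \<partial>\<nu> (Suc d))" .
qed

end

text \<open>Formulated through laws because the induction lowers \<open>d\<close>, whereas the
  random variables of the theorem are tied to one fixed \<open>d\<close>.\<close>

definition alternating_integral ::
  "(nat \<Rightarrow> real measure) \<Rightarrow> (nat \<Rightarrow> real measure) \<Rightarrow> nat \<Rightarrow> ((nat \<Rightarrow> real) \<Rightarrow> real) \<Rightarrow> real" where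
  "alternating_integral \<mu>X \<mu>Y d f =
     (\<Sum>A\<in>Pow {1..d}. (-1) ^ card A *
        (\<integral>y. f y \<partial>PiM {1..d} (\<lambda>i. if i \<in> A then \<mu>X i else \<mu>Y i)))"

locale box_prob_families =
  X: box_prob_family I a b \<mu>X + Y: box_prob_family I a b \<mu>Y for I a b \<mu>X \<mu>Y
begin

text \<open>Each term of the alternating sum integrates over such a mixed family, so integrability,
  bounds and Fubini become available for every \<open>A\<close>.\<close>

sublocale mix: box_prob_family I a b "\<lambda>i. if i \<in> A then \<mu>X i else \<mu>Y i" for A
proof (rule box_prob_family.intro)
  fix i
  show "prob_space (if i \<in> A then \<mu>X i else \<mu>Y i)"
    "AE t in if i \<in> A then \<mu>X i else \<mu>Y i. t \<in> {a i..b i}"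
    by (cases "i \<in> A"; simp only: if_True if_False X.prob_space_family Y.prob_space_family
        X.AE_family Y.AE_family)+
  show "sets (if i \<in> A then \<mu>X i else \<mu>Y i) = sets (borel_on (I i))"
    by simp
qed (rule X.Icc_subset)

text \<open>The sections of \<open>f\<close> at \<open>p\<close>, \<open>q\<close>, \<open>r\<close>
  are continuous, hence integrable under every mixed product, and integration is linear on
  them.\<close>

lemma alternating_integral_divided_difference:
  assumes f: "continuous_on (PiE {1..Suc d} I) f" and sub: "{p, q, r} \<subseteq> I (Suc d)"
  shows "alternating_integral \<mu>X \<mu>Y d
      (\<lambda>y. divided_difference [p, q, r] (\<lambda>t. f (y(Suc d := t)))) =
    divided_difference [p, q, r]
      (\<lambda>t. alternating_integral \<mu>X \<mu>Y d (\<lambda>y. f (y(Suc d := t))))"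
proof -
  define N where "N A = PiM {1..d} (\<lambda>i. if i \<in> A then \<mu>X i else \<mu>Y i)" for A
  define F where "F t y = f (y(Suc d := t))" for t y
  have "integrable (N A) (F t)" if "t \<in> {p, q, r}" for A t
    unfolding N_def F_def
    using that sub by (intro mix.integrable_box continuous_on_PiE_fun_upd f finite_atLeastAtMost) blast
  then have int: "integrable (N A) (F p)" "integrable (N A) (F q)" "integrable (N A) (F r)" for A
    by simp_all
  show ?thesis
    unfolding alternating_integral_def divided_difference_3
    unfolding N_def[symmetric] F_def[symmetric]
    by (simp add: int sum_subtractf right_diff_distrib diff_divide_distrib sum_divide_distrib)
qed

text \<open>Pair each \<open>A \<subseteq> {1..d}\<close> with \<open>insert (Suc d) A\<close>: the
  sign flips and the law of the last coordinate changes from \<open>\<mu>Y\<close> to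
  \<open>\<mu>X\<close>. Fubini isolates that coordinate.\<close>

lemma
  assumes f: "continuous_on (PiE {1..Suc d} I) f"
  shows measurable_alternating_integral:
      "(\<lambda>t. alternating_integral \<mu>X \<mu>Y d (\<lambda>y. f (y(Suc d := t)))) \<in>
         borel_measurable (borel_on (I (Suc d)))"
    and alternating_integral_Suc: "alternating_integral \<mu>X \<mu>Y (Suc d) f =
      (\<integral>t. alternating_integral \<mu>X \<mu>Y d (\<lambda>y. f (y(Suc d := t))) \<partial>\<mu>Y (Suc d)) -
      (\<integral>t. alternating_integral \<mu>X \<mu>Y d (\<lambda>y. f (y(Suc d := t))) \<partial>\<mu>X (Suc d))"
proof -
  define N where "N A = PiM {1..d} (\<lambda>i. if i \<in> A then \<mu>X i else \<mu>Y i)" for A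
  define h where "h A t = (\<integral>y. f (y(Suc d := t)) \<partial>N A)" for A t
  have alt: "alternating_integral \<mu>X \<mu>Y d (\<lambda>y. f (y(Suc d := t))) =
      (\<Sum>A\<in>Pow {1..d}. (-1) ^ card A * h A t)" for t
    by (simp add: alternating_integral_def h_def N_def)
  \<comment> \<open>A product over \<open>{1..d}\<close> does not see the index
    \<open>Suc d\<close>, so both members of a pair share the inner integral
    \<open>h A\<close>.\<close>
  have N_insert: "N (insert (Suc d) A) = N A" for A
    unfolding N_def by (rule PiM_cong) auto
  have *: "integrable (\<mu>Y (Suc d)) (h A)" "integrable (\<mu>X (Suc d)) (h A)"
    "(\<integral>y. f y \<partial>PiM {1..Suc d} (\<lambda>i. if i \<in> A then \<mu>X i else \<mu>Y i)) = (\<integral>t. h A t \<partial>\<mu>Y (Suc d))"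
    "(\<integral>y. f y \<partial>PiM {1..Suc d} (\<lambda>i. if i \<in> insert (Suc d) A then \<mu>X i else \<mu>Y i)) =
      (\<integral>t. h A t \<partial>\<mu>X (Suc d))"
    if "A \<in> Pow {1..d}" for A
  proof -
    have "Suc d \<notin> A" using that by auto
    then show "integrable (\<mu>Y (Suc d)) (h A)"
      "(\<integral>y. f y \<partial>PiM {1..Suc d} (\<lambda>i. if i \<in> A then \<mu>X i else \<mu>Y i)) = (\<integral>t. h A t \<partial>\<mu>Y (Suc d))"
      using mix.integrable_box_section[OF f, of A] mix.integral_box_Suc[OF f, of A]
      unfolding N_def[symmetric] h_def[symmetric] by simp_all
    show "integrable (\<mu>X (Suc d)) (h A)"
      "(\<integral>y. f y \<partial>PiM {1..Suc d} (\<lambda>i. if i \<in> insert (Suc d) A then \<mu>X i else \<mu>Y i)) =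
        (\<integral>t. h A t \<partial>\<mu>X (Suc d))"
      using mix.integrable_box_section[OF f, of "insert (Suc d) A"]
        mix.integral_box_Suc[OF f, of "insert (Suc d) A"]
      unfolding N_def[symmetric] h_def[symmetric] N_insert h_def[of A, symmetric] by simp_all
  qed
  \<comment> \<open>Measurability in \<open>t\<close> is read off from the integrability that Fubini
    gives, as \<open>\<mu>Y (Suc d)\<close> has the sigma-algebra of
    \<open>borel_on (I (Suc d))\<close>.\<close>
  have "h A \<in> borel_measurable (borel_on (I (Suc d)))" if "A \<in> Pow {1..d}" for A
    using borel_measurable_integrable[OF *(1)[OF that]]
    by (simp only: measurable_cong_sets[OF Y.sets_family refl])
  then show "(\<lambda>t. alternating_integral \<mu>X \<mu>Y d (\<lambda>y. f (y(Suc d := t)))) \<in>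
      borel_measurable (borel_on (I (Suc d)))"
    unfolding alt by (intro borel_measurable_sum borel_measurable_times) auto
  have "alternating_integral \<mu>X \<mu>Y (Suc d) f =
      (\<Sum>A\<in>Pow {1..d}. (-1) ^ card A *
        (\<integral>y. f y \<partial>PiM {1..Suc d} (\<lambda>i. if i \<in> A then \<mu>X i else \<mu>Y i))) +
      (\<Sum>A\<in>Pow {1..d}. (-1) ^ card (insert (Suc d) A) *
        (\<integral>y. f y \<partial>PiM {1..Suc d} (\<lambda>i. if i \<in> insert (Suc d) A then \<mu>X i else \<mu>Y i)))"
  proof -
    have "inj_on (insert (Suc d)) (Pow {1..d})"
      by (rule inj_onI) (metis PowD Diff_insert_absorb atLeastAtMost_iff not_less_eq_eq order_refl subset_iff)
    moreover have "Pow {1..d} \<inter> insert (Suc d) ` Pow {1..d} = {}" by auto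
    moreover have "Pow {1..Suc d} = Pow {1..d} \<union> insert (Suc d) ` Pow {1..d}"
      by (simp add: atLeastAtMostSuc_conv Pow_insert)
    ultimately show ?thesis
      unfolding alternating_integral_def by (simp add: sum.union_disjoint sum.reindex)
  qed
  also have "\<dots> = (\<Sum>A\<in>Pow {1..d}. (-1) ^ card A * (\<integral>t. h A t \<partial>\<mu>Y (Suc d))) -
      (\<Sum>A\<in>Pow {1..d}. (-1) ^ card A * (\<integral>t. h A t \<partial>\<mu>X (Suc d)))"
  proof -
    have card: "card (insert (Suc d) A) = Suc (card A)" if "A \<in> Pow {1..d}" for A
      using that by (subst card_insert_disjoint) (auto intro: finite_subset)
    have "(\<Sum>A\<in>Pow {1..d}. (-1) ^ card (insert (Suc d) A) *
          (\<integral>y. f y \<partial>PiM {1..Suc d} (\<lambda>i. if i \<in> insert (Suc d) A then \<mu>X i else \<mu>Y i))) =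
        (\<Sum>A\<in>Pow {1..d}. - ((-1) ^ card A * (\<integral>t. h A t \<partial>\<mu>X (Suc d))))"
      by (rule sum.cong[OF refl]) (simp only: *(4) card power_Suc mult_minus1 mult_minus_left)
    moreover have "(\<Sum>A\<in>Pow {1..d}. (-1) ^ card A *
          (\<integral>y. f y \<partial>PiM {1..Suc d} (\<lambda>i. if i \<in> A then \<mu>X i else \<mu>Y i))) =
        (\<Sum>A\<in>Pow {1..d}. (-1) ^ card A * (\<integral>t. h A t \<partial>\<mu>Y (Suc d)))"
      by (intro sum.cong refl) (simp only: *(3))
    ultimately show ?thesis
      by (simp only: sum_negf)
  qed
  also have "\<dots> = (\<integral>t. (\<Sum>A\<in>Pow {1..d}. (-1) ^ card A * h A t) \<partial>\<mu>Y (Suc d)) -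
      (\<integral>t. (\<Sum>A\<in>Pow {1..d}. (-1) ^ card A * h A t) \<partial>\<mu>X (Suc d))"
    using * by (simp add: Bochner_Integration.integral_sum)
  finally show "alternating_integral \<mu>X \<mu>Y (Suc d) f =
      (\<integral>t. alternating_integral \<mu>X \<mu>Y d (\<lambda>y. f (y(Suc d := t))) \<partial>\<mu>Y (Suc d)) -
      (\<integral>t. alternating_integral \<mu>X \<mu>Y d (\<lambda>y. f (y(Suc d := t))) \<partial>\<mu>X (Suc d))"
    unfolding alt .
qed

text \<open>The sum has \<open>2 ^ d\<close> terms, each bounded by a bound of \<open>f\<close> on
  the compact box. This supplies the boundedness that the one-dimensional comparison asks
  for.\<close>

lemma bounded_alternating_integral:
  assumes f: "continuous_on (PiE {1..Suc d} I) f"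
  obtains B where "\<And>t. t \<in> {a (Suc d)..b (Suc d)} \<Longrightarrow>
    \<bar>alternating_integral \<mu>X \<mu>Y d (\<lambda>y. f (y(Suc d := t)))\<bar> \<le> B"
proof -
  let ?K = "\<lambda>J. \<Pi>\<^sub>E i\<in>J. {a i..b i}"
  obtain B where B: "\<And>y. y \<in> ?K {1..Suc d} \<Longrightarrow> \<bar>f y\<bar> \<le> B"
    by (rule X.bounded_box[OF f]) blast
  have "\<bar>alternating_integral \<mu>X \<mu>Y d (\<lambda>y. f (y(Suc d := t)))\<bar> \<le> (\<Sum>A\<in>Pow {1..d}. B)"
    if t: "t \<in> {a (Suc d)..b (Suc d)}" for t
    unfolding alternating_integral_def
  proof (rule order_trans[OF sum_abs sum_mono])
    fix A
    have "\<bar>f (y(Suc d := t))\<bar> \<le> B" if "y \<in> ?K {1..d}" for y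
    proof -
      have "y(Suc d := t) \<in> ?K {1..Suc d}"
        using that t by (auto simp: PiE_def Pi_def extensional_def le_Suc_eq)
      then show ?thesis by (rule B)
    qed
    moreover have "t \<in> I (Suc d)" using t X.Icc_subset by blast
    ultimately show "\<bar>(-1) ^ card A *
        (\<integral>y. f (y(Suc d := t)) \<partial>PiM {1..d} (\<lambda>i. if i \<in> A then \<mu>X i else \<mu>Y i))\<bar> \<le> B"
      using mix.abs_integral_box_le[OF continuous_on_PiE_fun_upd[OF f]]
      by (simp only: abs_mult power_abs finite_atLeastAtMost) simp
  qed
  then show thesis by (rule that)
qed

text \<open>The assumption \<open>order\<close> is a convex-order relation between the laws at each
  index, and it is all that the induction uses of their particular form. Box convexity is asked for
  on the compact box, where the last-variable function must be shown convex.\<close>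

theorem alternating_integral_nonneg:
  assumes order: "\<And>i g B. g \<in> borel_measurable (borel_on (I i)) \<Longrightarrow>
      (\<And>t. t \<in> {a i..b i} \<Longrightarrow> \<bar>g t\<bar> \<le> B) \<Longrightarrow> convex_on {a i..b i} g \<Longrightarrow>
      (\<integral>t. g t \<partial>\<mu>X i) \<le> (\<integral>t. g t \<partial>\<mu>Y i)"
    and f: "continuous_on (PiE {1..d} I) f" and box: "box_2_convex d (\<lambda>i. {a i..b i}) f"
  shows "alternating_integral \<mu>X \<mu>Y d f \<ge> 0"
  using f box
proof (induction d arbitrary: f)
  \<comment> \<open>Only \<open>A = {}\<close> contributes, and the 0-fold divided difference is the
    value of \<open>f\<close> at the empty point.\<close>
  case 0
  then show ?case
    by (simp add: alternating_integral_def box_2_convex_def PiM_empty lebesgue_integral_count_space_finite)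
next
  case (Suc d)
  let ?g = "\<lambda>t. alternating_integral \<mu>X \<mu>Y d (\<lambda>y. f (y(Suc d := t)))"
  obtain B where B: "\<And>t. t \<in> {a (Suc d)..b (Suc d)} \<Longrightarrow> \<bar>?g t\<bar> \<le> B"
    by (rule bounded_alternating_integral[OF Suc.prems(1)]) blast
  have conv: "convex_on {a (Suc d)..b (Suc d)} ?g"
  proof (rule convex_on_if_divided_difference_nonneg)
    fix p q r assume pqr: "{p, q, r} \<subseteq> {a (Suc d)..b (Suc d)}" "p < q" "q < r"
    let ?f' = "\<lambda>y. divided_difference [p, q, r] (\<lambda>t. f (y(Suc d := t)))"
    have I: "{p, q, r} \<subseteq> I (Suc d)" using pqr(1) X.Icc_subset by blast
    then have "continuous_on (PiE {1..d} I) ?f'"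
      unfolding divided_difference_3
      using pqr(2,3) by (intro continuous_intros continuous_on_PiE_fun_upd[OF Suc.prems(1)]) simp_all
    moreover have "box_2_convex d (\<lambda>i. {a i..b i}) ?f'"
      using pqr by (intro box_2_convex_divided_difference Suc.prems) simp_all
    ultimately have "alternating_integral \<mu>X \<mu>Y d ?f' \<ge> 0"
      by (rule Suc.IH)
    then show "divided_difference [p, q, r] ?g \<ge> 0"
      by (simp only: alternating_integral_divided_difference[OF Suc.prems(1) I])
  qed simp
  have "(\<integral>t. ?g t \<partial>\<mu>X (Suc d)) \<le> (\<integral>t. ?g t \<partial>\<mu>Y (Suc d))"
    by (rule order[OF measurable_alternating_integral[OF Suc.prems(1)] _ conv]) (rule B)
  then show ?case
    unfolding alternating_integral_Suc[OF Suc.prems(1)] by simp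
qed

end

section \<open>From independent random variables to product measures\<close>

lemma (in prob_space) expectation_indep_vars_continuous:
  fixes f :: "(nat \<Rightarrow> real) \<Rightarrow> real" and Z :: "nat \<Rightarrow> 'a \<Rightarrow> real"
  assumes indep: "indep_vars (\<lambda>i. borel_on (I i)) Z J" and "J \<noteq> {}"
    and f: "continuous_on (PiE J I) f"
  shows "expectation (\<lambda>\<omega>. f (\<lambda>i\<in>J. Z i \<omega>)) =
    (\<integral>y. f y \<partial>PiM J (\<lambda>i. distr M (borel_on (I i)) (Z i)))"
proof -
  let ?P = "PiM J (\<lambda>i. borel_on (I i))"
  have rv: "Z i \<in> M \<rightarrow>\<^sub>M borel_on (I i)" if "i \<in> J" for i
    using indep that by (simp add: indep_vars_def)
  then have Z: "(\<lambda>\<omega>. \<lambda>i\<in>J. Z i \<omega>) \<in> M \<rightarrow>\<^sub>M ?P"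
    by (intro measurable_restrict)
  \<comment> \<open>Independence enters here: for nonempty \<open>J\<close> it is equivalent to the
    joint law being the product of the marginal laws.\<close>
  have "distr M ?P (\<lambda>\<omega>. \<lambda>i\<in>J. Z i \<omega>) = PiM J (\<lambda>i. distr M (borel_on (I i)) (Z i))"
    using indep_vars_iff_distr_eq_PiM'[where M' = "\<lambda>i. borel_on (I i)", OF \<open>J \<noteq> {}\<close> rv] indep
    by simp
  then show ?thesis
    using integral_distr[OF Z borel_measurable_PiM_continuous_on[OF f]] by simp
qed

theorem theorem51:
  fixes d :: nat
    and I :: "nat \<Rightarrow> real set"
    and a b :: "nat \<Rightarrow> real"
    and \<mu>X \<mu>Y :: "nat \<Rightarrow> real measure"
    and M :: "nat set \<Rightarrow> 'a measure"
    and Z :: "nat set \<Rightarrow> nat \<Rightarrow> 'a \<Rightarrow> real"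
    and f :: "(nat \<Rightarrow> real) \<Rightarrow> real"
  assumes "d \<ge> 1"
    and "\<And>i. i \<in> {1..d} \<Longrightarrow> is_interval (I i)"
    and "\<And>i. i \<in> {1..d} \<Longrightarrow> a i \<in> I i \<and> b i \<in> I i \<and> a i < b i"
    and "\<And>i. i \<in> {1..d} \<Longrightarrow> prob_space (\<mu>X i) \<and> sets (\<mu>X i) = sets (borel_on (I i))"
    and "\<And>i. i \<in> {1..d} \<Longrightarrow> prob_space (\<mu>Y i) \<and> sets (\<mu>Y i) = sets (borel_on (I i))"
    and "\<And>A. A \<subseteq> {1..d} \<Longrightarrow> prob_space (M A)"
    and "\<And>A. A \<subseteq> {1..d} \<Longrightarrow>
           prob_space.indep_vars (M A) (\<lambda>i. borel_on (I i)) (Z A) {1..d}"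
    and "\<And>A i. A \<subseteq> {1..d} \<Longrightarrow> i \<in> {1..d} \<Longrightarrow>
           distr (M A) (borel_on (I i)) (Z A i) = (if i \<in> A then \<mu>X i else \<mu>Y i)"
    and "continuous_on (PiE {1..d} I) f"
    and "box_2_convex d I f"
    and "(\<forall>i\<in>{1..d}. \<mu>X i = dirac_on (I i) ((a i + b i) / 2)
                    \<and> \<mu>Y i = uniform_on (I i) (a i) (b i))
       \<or> (\<forall>i\<in>{1..d}. \<mu>X i = uniform_on (I i) (a i) (b i)
                    \<and> \<mu>Y i = endpoints_on (I i) (a i) (b i))"
  shows "(\<Sum>A\<in>Pow {1..d}. (-1) ^ card A *
           prob_space.expectation (M A) (\<lambda>\<omega>. f (\<lambda>i\<in>{1..d}. Z A i \<omega>))) \<ge> 0"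
proof -
  \<comment> \<open>Only the indices in \<open>{1..d}\<close> carry data; all others are treated as copies of \<open>1\<close>.\<close>
  define \<sigma> where "\<sigma> i = (if i \<in> {1..d} then i else 1)" for i
  have \<sigma>: "\<sigma> i \<in> {1..d}" for i using assms(1) by (simp add: \<sigma>_def)
  have \<sigma>_id: "\<sigma> i = i" if "i \<in> {1..d}" for i using that by (simp add: \<sigma>_def)
  note J = assms(2)[OF \<sigma>]
    assms(3)[OF \<sigma>, THEN conjunct1] assms(3)[OF \<sigma>, THEN conjunct2, THEN conjunct1]
    assms(3)[OF \<sigma>, THEN conjunct2, THEN conjunct2]
  have mid: "(a (\<sigma> i) + b (\<sigma> i)) / 2 \<in> {a (\<sigma> i)..b (\<sigma> i)}" for i
    using J(4)[of i] by simp
  \<comment> \<open>The choice between the two cases is kept as a disjunction at each index: the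
    comparison is made coordinate by coordinate, so both cases are handled at once.\<close>
  have laws: "\<mu>X (\<sigma> i) = dirac_on (I (\<sigma> i)) ((a (\<sigma> i) + b (\<sigma> i)) / 2) \<and>
        \<mu>Y (\<sigma> i) = uniform_on (I (\<sigma> i)) (a (\<sigma> i)) (b (\<sigma> i)) \<or>
      \<mu>X (\<sigma> i) = uniform_on (I (\<sigma> i)) (a (\<sigma> i)) (b (\<sigma> i)) \<and>
        \<mu>Y (\<sigma> i) = endpoints_on (I (\<sigma> i)) (a (\<sigma> i)) (b (\<sigma> i))" for i
    using assms(11) \<sigma> by blast
  have AE: "AE t in endpoints_on (I (\<sigma> i)) (a (\<sigma> i)) (b (\<sigma> i)). t \<in> {a (\<sigma> i)..b (\<sigma> i)}" for i
    using AE_endpoints_on[OF J] by (rule eventually_mono) (use J(4)[of i] in auto)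
  interpret box_prob_families "I \<circ> \<sigma>" "a \<circ> \<sigma>" "b \<circ> \<sigma>" "\<mu>X \<circ> \<sigma>" "\<mu>Y \<circ> \<sigma>"
  proof (intro box_prob_families.intro box_prob_family.intro, unfold comp_def)
    fix i
    show "prob_space (\<mu>X (\<sigma> i))" "sets (\<mu>X (\<sigma> i)) = sets (borel_on (I (\<sigma> i)))"
      "prob_space (\<mu>Y (\<sigma> i))" "sets (\<mu>Y (\<sigma> i)) = sets (borel_on (I (\<sigma> i)))"
      using assms(4)[OF \<sigma>] assms(5)[OF \<sigma>] by blast+
    show "AE t in \<mu>X (\<sigma> i). t \<in> {a (\<sigma> i)..b (\<sigma> i)}" "AE t in \<mu>Y (\<sigma> i). t \<in> {a (\<sigma> i)..b (\<sigma> i)}"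
      using laws[of i] AE_uniform_on[OF J] AE_dirac_on[OF J mid] AE by metis+
  qed (rule Icc_subset_interval[OF J])+
  have PiE_\<sigma>: "PiE {1..d} (I \<circ> \<sigma>) = PiE {1..d} I"
    by (rule PiE_cong) (simp add: \<sigma>_id)
  have "alternating_integral (\<mu>X \<circ> \<sigma>) (\<mu>Y \<circ> \<sigma>) d f \<ge> 0"
  proof (rule alternating_integral_nonneg)
    fix i B and g :: "real \<Rightarrow> real"
    assume "g \<in> borel_measurable (borel_on ((I \<circ> \<sigma>) i))"
      and "\<And>t. t \<in> {(a \<circ> \<sigma>) i..(b \<circ> \<sigma>) i} \<Longrightarrow> \<bar>g t\<bar> \<le> B"
      and "convex_on {(a \<circ> \<sigma>) i..(b \<circ> \<sigma>) i} g"
    then have g: "g \<in> borel_measurable (borel_on (I (\<sigma> i)))"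
      "convex_on {a (\<sigma> i)..b (\<sigma> i)} g" "\<And>t. t \<in> {a (\<sigma> i)..b (\<sigma> i)} \<Longrightarrow> \<bar>g t\<bar> \<le> B"
      by simp_all
    have "(a (\<sigma> i) + b (\<sigma> i)) / 2 \<in> I (\<sigma> i)"
      using mid Icc_subset_interval[OF J] by blast
    \<comment> \<open>In case (a) the left side is the value of \<open>g\<close> at the midpoint; in
      case (b) the right side is the mean of its endpoint values.\<close>
    then show "(\<integral>t. g t \<partial>(\<mu>X \<circ> \<sigma>) i) \<le> (\<integral>t. g t \<partial>(\<mu>Y \<circ> \<sigma>) i)"
      using laws[of i] hermite_hadamard_midpoint[OF J g] hermite_hadamard_endpoints[OF J g]
        integral_dirac_on[OF J _ g(1)] integral_endpoints_on[OF J g(1)]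
      by auto
  next
    show "continuous_on (PiE {1..d} (I \<circ> \<sigma>)) f"
      using assms(9) by (simp only: PiE_\<sigma>)
    show "box_2_convex d (\<lambda>i. {(a \<circ> \<sigma>) i..(b \<circ> \<sigma>) i}) f"
    proof (rule box_2_convex_mono[OF assms(10)])
      fix i assume "i \<in> {1..d}"
      then show "{(a \<circ> \<sigma>) i..(b \<circ> \<sigma>) i} \<subseteq> I i"
        using Icc_subset_interval[OF J, of i] by (simp only: comp_def \<sigma>_id)
    qed
  qed
  also have "alternating_integral (\<mu>X \<circ> \<sigma>) (\<mu>Y \<circ> \<sigma>) d f =
      (\<Sum>A\<in>Pow {1..d}. (-1) ^ card A *
        prob_space.expectation (M A) (\<lambda>\<omega>. f (\<lambda>i\<in>{1..d}. Z A i \<omega>)))"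
    unfolding alternating_integral_def
  proof (rule sum.cong[OF refl])
    fix A assume "A \<in> Pow {1..d}"
    then have A: "A \<subseteq> {1..d}" by simp
    interpret prob_space "M A" by (rule assms(6)[OF A])
    have "PiM {1..d} (\<lambda>i. distr (M A) (borel_on (I i)) (Z A i)) =
        PiM {1..d} (\<lambda>i. if i \<in> A then (\<mu>X \<circ> \<sigma>) i else (\<mu>Y \<circ> \<sigma>) i)"
      by (rule PiM_cong) (simp_all add: assms(8)[OF A] \<sigma>_id)
    \<comment> \<open>Here \<open>d \<ge> 1\<close> is used: the product form of independence is
      applied to a nonempty index set.\<close>
    moreover have "{1..d} \<noteq> {}" using assms(1) by simp
    ultimately show "(-1) ^ card A *
        (\<integral>y. f y \<partial>PiM {1..d} (\<lambda>i. if i \<in> A then (\<mu>X \<circ> \<sigma>) i else (\<mu>Y \<circ> \<sigma>) i)) =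
      (-1) ^ card A * expectation (\<lambda>\<omega>. f (\<lambda>i\<in>{1..d}. Z A i \<omega>))"
      using expectation_indep_vars_continuous[OF assms(7)[OF A] _ assms(9)] by simp
  qed
  finally show ?thesis .
qed

end
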